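(* Let $\Phi=(G,\varphi)$ be a $\mathbb{T}$-gain graph, with characteristic polynomial $P_\Phi(x)=\det(xI-A(\Phi))$, and let $m_G(x)$ be the matching polynomial of $G$. Then $$P_\Phi(x)=m_G(x)+\sum_{K}(-2)^{n(K)}\prod_{C\in K}\Re(\varphi(C))\,m_{G-K}(x),$$ where the sum runs over all nonempty subgraphs $K$ of $G$ that are unions of vertex-disjoint cycles, $n(K)$ is the number of cycles (components) of $K$, the product is over all cycles $C$ of $K$, and $G-K$ is the graph obtained from $G$ by deleting the vertices of $K$.
   Context: Let $\mathbb{T}=\{z\in\mathbb{C}:|z|=1\}$. A $\mathbb{T}$-gain graph $\Phi=(G,\varphi)$ is a simple graph $G$ with a map $\varphi$ assigning to each oriented edge $\vec e_{p,q}$ a value in $\mathbb{T}$ with $\varphi(\vec{e}_{p,q})=\varphi(\vec{e}_{q,p})^{-1}$. Its adjacency matrix $A(\Phi)$ is the Hermitian matrix with $(p,q)$ entry $\varphi(\vec{e}_{p,q})$ if $v_p\sim v_q$ and $0$ otherwise. For a cycle $C: v_1\sim\cdots\sim v_k\sim v_1$, $\varphi(C)$ denotes its gain $\varphi(\vec e_{1,2})\cdots\varphi(\vec e_{k,1})$ for one orientation; $\Re(\varphi(C))$ (its real part) does not depend on the orientation chosen. For a graph $H$ on $n$ vertices, $m(H,j)$ is the number of matchings of size $j$ in $H$ (with $m(H,0)=1$), and the matching polynomial is $m_H(x)=\sum_{j=0}^{\lfloor n/2\rfloor}(-1)^j m(H,j)x^{n-2j}$ (the matching polynomial of the graph with no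 vertices is $1$). *)

theory Defs
  imports
    "Graph_Theory.Pair_Digraph"
    "Graph_Theory.Digraph_Component"
    "Jordan_Normal_Form.Char_Poly"
begin

text \<open>
  A finite simple graph is a \<^locale>\<open>pair_graph\<close>: a finite, loop-free, symmetric relation on
  its vertex set.  Each edge contributes the two arcs \<open>(p, q)\<close> and \<open>(q, p)\<close>, which are its two
  orientations.  A gain function takes arcs as arguments; its values off the arcs are irrelevant.
\<close>

locale gain_graph = pair_graph G for G :: "'a pair_pre_digraph" +
  fixes \<phi> :: "'a \<times> 'a \<Rightarrow> complex"
  assumes gain_unit: "e \<in> parcs G \<Longrightarrow> norm (\<phi> e) = 1"
    and gain_reverse: "(p, q) \<in> parcs G \<Longrightarrow> \<phi> (p, q) = inverse (\<phi> (q, p))"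

text \<open>The list \<open>vs\<close> is the enumeration of the vertices that indexes the rows and columns.\<close>

definition gain_adjacency_mat ::
    "'a pair_pre_digraph \<Rightarrow> ('a \<times> 'a \<Rightarrow> complex) \<Rightarrow> 'a list \<Rightarrow> complex mat" where
  "gain_adjacency_mat G \<phi> vs =
    mat (length vs) (length vs)
      (\<lambda>(i, j). if (vs ! i, vs ! j) \<in> parcs G then \<phi> (vs ! i, vs ! j) else 0)"

definition edges :: "'a pair_pre_digraph \<Rightarrow> 'a set set" where
  "edges G = {{u, v} | u v. (u, v) \<in> parcs G}"

definition num_matchings :: "'a pair_pre_digraph \<Rightarrow> nat \<Rightarrow> nat" where
  "num_matchings G j = card {M. M \<subseteq> edges G \<and> pairwise disjnt M \<and> card M = j}"

definition matching_poly :: "'a pair_pre_digraph \<Rightarrow> 'b::comm_ring_1 poly" where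
  "matching_poly G =
    (let n = card (pverts G)
     in \<Sum>j = 0..n div 2. monom ((- 1) ^ j * of_nat (num_matchings G j)) (n - 2 * j))"

definition delete_verts :: "'a pair_pre_digraph \<Rightarrow> 'a set \<Rightarrow> 'a pair_pre_digraph" where
  "delete_verts G S =
    \<lparr>pverts = pverts G - S, parcs = {(u, v) \<in> parcs G. u \<notin> S \<and> v \<notin> S}\<rparr>"

text \<open>The arcs \<open>(v\<^sub>1, v\<^sub>2), \<dots>, (v\<^sub>k\<^sub>-\<^sub>1, v\<^sub>k), (v\<^sub>k, v\<^sub>1)\<close> of the closed walk along
  \<open>[v\<^sub>1, \<dots>, v\<^sub>k]\<close>.\<close>

definition closed_walk_arcs :: "'a list \<Rightarrow> ('a \<times> 'a) list" where
  "closed_walk_arcs vs = zip vs (rotate1 vs)"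

text \<open>Cycles are undirected graphs with at least three vertices, not closed walks: the library's
  \<open>cycle\<close> distinguishes starting points and orientations and also admits
  \<open>[(u, v), (v, u)]\<close>.  Here \<open>vs\<close> is one of the \<open>2 k\<close> ways of running around the cycle \<open>C\<close>.\<close>

definition traverses :: "'a list \<Rightarrow> 'a pair_pre_digraph \<Rightarrow> bool" where
  "traverses vs C \<longleftrightarrow>
    3 \<le> length vs \<and> distinct vs \<and> pverts C = set vs \<and>
    parcs C = set (closed_walk_arcs vs) \<union> (set (closed_walk_arcs vs))\<inverse>"

definition is_cycle :: "'a pair_pre_digraph \<Rightarrow> bool" where
  "is_cycle C \<longleftrightarrow> (\<exists>vs. traverses vs C)"

text \<open>The starting point does not affect the gain of a cycle, and reversing the orientation
  conjugates it, so only the real part is independent of the choice made here.\<close>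

definition cycle_gain :: "('a \<times> 'a \<Rightarrow> complex) \<Rightarrow> 'a pair_pre_digraph \<Rightarrow> complex" where
  "cycle_gain \<phi> C = prod_list (map \<phi> (closed_walk_arcs (SOME vs. traverses vs C)))"

definition cycles_of :: "'a pair_pre_digraph \<Rightarrow> 'a pair_pre_digraph set" where
  "cycles_of K = {C. is_cycle C \<and> subgraph (with_proj C) (with_proj K)}"

definition disjoint_union_of_cycles :: "'a pair_pre_digraph \<Rightarrow> bool" where
  "disjoint_union_of_cycles K \<longleftrightarrow>
    (\<exists>\<C>. (\<forall>C \<in> \<C>. is_cycle C) \<and>
         pairwise (\<lambda>C D. disjnt (pverts C) (pverts D)) \<C> \<and>
         pverts K = (\<Union>C \<in> \<C>. pverts C) \<and> parcs K = (\<Union>C \<in> \<C>. parcs C))"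

definition cycle_subgraphs :: "'a pair_pre_digraph \<Rightarrow> 'a pair_pre_digraph set" where
  "cycle_subgraphs G =
    {K. subgraph (with_proj K) (with_proj G) \<and> pverts K \<noteq> {} \<and> disjoint_union_of_cycles K}"

end

theory Submission
  imports Defs "HOL-Combinatorics.Cycles"
begin

text \<open>
  Fix a vertex \<open>v\<close>.  Grouping the permutations in \<open>det (x I - A)\<close> by the cycle through \<open>v\<close> gives
  \<open>P(G) = x P(G - v) - (\<Sum>e through v. P(G - e)) - (\<Sum>C through v. 2 \<Re>(\<phi>(C)) P(G - C))\<close>,
  where a cycle \<open>C\<close> of \<open>G\<close> contributes its two orientations, whose gains are conjugate.
  The right-hand side of the theorem is a sum over all packings of \<open>G\<close> by disjoint edges (weight
  \<open>-1\<close>) and cycles (weight \<open>-2 \<Re>(\<phi>(C))\<close>), each packing carrying the power of \<open>x\<close> given by the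
  number of uncovered vertices.  Distinguishing whether and by which piece \<open>v\<close> is covered shows
  that it satisfies the same recursion.
\<close>

section \<open>Expanding a determinant along the cycle through a vertex\<close>

text \<open>A permutation cycle of length k >= 2 has sign (-1)^(k-1), and its k off-diagonal entries
  of x I - A contribute (-1)^k times its gain, so it counts with -1 whatever its length. For k = 2
  the gain is z * z^-1 = 1, which is where the signs of the matching polynomial come from. The
  determinant is indexed by a set of vertices instead of matrix positions, so deleting vertices only
  shrinks the index set and no submatrix has to be renumbered. The obstacle is the passage from
  lists, which the determinant produces, to undirected cycles. Two facts bridge it: a cycle has
  exactly two traversals from a given start, and the cycles contained in a vertex-disjoint union are
  exactly its members. The second one ties \<open>cycles_of K\<close> to packings. Edges and cycles
  are joined in one sum type, so that a single recursion treats both.\<close>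

definition set_det :: "('a \<Rightarrow> 'a \<Rightarrow> 'b::comm_ring_1) \<Rightarrow> 'a set \<Rightarrow> 'b" where
  "set_det M S = (\<Sum>p | p permutes S. of_int (sign p) * (\<Prod>i\<in>S. M i (p i)))"

lemma set_det_empty [simp]: "set_det M {} = 1"
  by (simp add: set_det_def)

lemma set_det_cong:
  assumes "\<And>i j. i \<in> S \<Longrightarrow> j \<in> S \<Longrightarrow> M i j = N i j"
  shows "set_det M S = set_det N S"
  unfolding set_det_def
  by (intro sum.cong refl arg_cong2[where f = "(*)"] prod.cong) (auto simp: assms permutes_in_image)

text \<open>Transporting permutations along the enumeration preserves signs and products, so the
  order chosen by \<open>vs\<close> drops out of the determinant.\<close>

lemma det_eq_set_det:
  assumes "A \<in> carrier_mat (length vs) (length vs)" and "distinct vs"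
    and "\<And>i j. i < length vs \<Longrightarrow> j < length vs \<Longrightarrow> A $$ (i, j) = M (vs ! i) (vs ! j)"
  shows "det A = set_det M (set vs)"
proof -
  let ?I = "{0..<length vs}"
  have bij: "bij_betw ((!) vs) ?I (set vs)"
    using bij_betw_nth[OF assms(2)] by (simp add: atLeast0LessThan)
  hence inj: "inj_on ((!) vs) ?I"
    by (rule bij_betw_imp_inj_on)
  have perm: "map_permutation ?I ((!) vs) p permutes set vs" if "p permutes ?I" for p
    using map_permutation_permutes[OF bij that] .
  have "det A = (\<Sum>p | p permutes ?I. of_int (sign p) * (\<Prod>i\<in>?I. M (vs ! i) (vs ! p i)))"
    unfolding det_def'[OF assms(1)]
    by (intro sum.cong refl arg_cong2[where f = "(*)"] prod.cong)
       (auto simp: assms(3) dest: permutes_in_image)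
  also have "\<dots> = (\<Sum>p | p permutes set vs. of_int (sign p) * (\<Prod>i\<in>set vs. M i (p i)))"
  proof (rule sum.reindex_bij_witness[where
        j = "map_permutation ?I ((!) vs)"
        and i = "map_permutation (set vs) (inv_into ?I ((!) vs))"], goal_cases)
    case (1 p)
    thus ?case
      using map_permutation_compose_inv[OF bij, of p] inv_into_f_f[OF inj] by simp
  next
    case (2 p)
    thus ?case using perm by simp
  next
    case (3 p)
    have "map_permutation ?I ((!) vs) (map_permutation (set vs) (inv_into ?I ((!) vs)) p) = p"
      by (rule map_permutation_compose_inv[OF bij_betw_inv_into[OF bij]])
         (use 3 bij in \<open>auto simp: bij_betw_inv_into_right\<close>)
    thus ?case .
  next
    case (4 p)
    thus ?case using map_permutation_permutes[OF bij_betw_inv_into[OF bij]] by simp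
  next
    case (5 p)
    have "(\<Prod>i\<in>set vs. M i (map_permutation ?I ((!) vs) p i)) =
        (\<Prod>i\<in>?I. M (vs ! i) (map_permutation ?I ((!) vs) p (vs ! i)))"
      by (rule prod.reindex_bij_betw[OF bij, symmetric])
    also have "\<dots> = (\<Prod>i\<in>?I. M (vs ! i) (vs ! p i))"
      by (intro prod.cong refl) (simp add: map_permutation_apply[OF inj])
    finally show ?case
      using sign_map_permutation[OF inj, of p] 5 by simp
  qed
  finally show ?thesis
    by (simp add: set_det_def)
qed

lemma sign_cycle_of_list:
  assumes "distinct l"
  shows "sign (cycle_of_list l) = (- 1) ^ (length l - 1)"
  using assms
proof (induction l rule: cycle_of_list.induct)
  case (1 i j cs)
  have "sign (cycle_of_list (i # j # cs)) = sign (transpose i j) * sign (cycle_of_list (j # cs))"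
    unfolding cycle_of_list.simps by (rule sign_compose[OF permutation_swap_id permutation_of_cycle])
  thus ?case
    using 1 by (simp add: sign_swap_id del: cycle_of_list.simps)
qed simp_all

lemma map_cycle_of_list:
  assumes "distinct l"
  shows "map (cycle_of_list l) l = rotate1 l"
  using cyclic_rotation[OF assms, of 1] by simp

text \<open>\<open>q\<close> fixes every entry of \<open>l\<close>, so the composite moves along
  \<open>l\<close> as the cycle does. Hence the list is recovered from the composite as the orbit of
  its head, which makes the factorization below invertible.\<close>

lemma support_cycle_comp:
  assumes "distinct l" "l \<noteq> []" and q: "q permutes S - set l"
  shows "support (cycle_of_list l \<circ> q) (hd l) = l"
proof -
  define p where "p = cycle_of_list l \<circ> q"
  have step: "p (l ! i) = l ! (Suc i mod length l)" if "i < length l" for i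
  proof -
    have "p (l ! i) = cycle_of_list l (l ! i)"
      using that q by (simp add: p_def permutes_not_in)
    also have "\<dots> = rotate1 l ! i"
      using map_cycle_of_list[OF assms(1)] that by (metis nth_map)
    finally show ?thesis
      using that by (simp add: nth_rotate1)
  qed
  have iter: "(p ^^ i) (hd l) = l ! i" if "i < length l" for i
    using that
  proof (induction i)
    case 0
    thus ?case using assms(2) by (simp add: hd_conv_nth)
  next
    case (Suc i)
    thus ?case by (simp add: step)
  qed
  have pos: "length l > 0"
    using assms(2) by simp
  have "least_power p (hd l) = length l"
    unfolding least_power_def
  proof (rule Least_equality)
    have "(p ^^ Suc (length l - 1)) (hd l) = hd l"
      using pos iter[of "length l - 1"] step[of "length l - 1"]
      by (simp only: funpow.simps o_apply) (simp add: hd_conv_nth)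
    thus "(p ^^ length l) (hd l) = hd l \<and> length l > 0"
      using pos by (simp only: Suc_diff_1 simp_thms)
  next
    fix n assume n: "(p ^^ n) (hd l) = hd l \<and> n > 0"
    show "length l \<le> n"
    proof (rule ccontr)
      assume "\<not> length l \<le> n"
      hence "l ! n = l ! 0"
        using n iter[of n] assms(2) by (simp add: hd_conv_nth)
      thus False
        using n \<open>\<not> length l \<le> n\<close> assms(1) pos by (simp add: nth_eq_iff_index_eq)
    qed
  qed
  hence "support p (hd l) = map ((!) l) [0..<length l]"
    by (auto simp: iter)
  thus ?thesis
    by (simp add: p_def map_nth)
qed

lemma finite_distinct_lists_subset:
  assumes "finite S"
  shows "finite {l. distinct l \<and> set l \<subseteq> S \<and> P l}"
  by (rule finite_subset[OF _ finite_subset_distinct[OF assms]]) auto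

text \<open>A permutation of \<open>S\<close> factors uniquely into the cycle through
  \<open>v\<close> and a permutation of the vertices off that cycle. Requiring
  \<open>hd l = v\<close> selects one list among the rotations of the cycle; \<open>[v]\<close> is
  the case of a fixed point.\<close>

lemma set_det_expand_cycle:
  assumes "finite S" and v: "v \<in> S"
  shows "set_det M S =
    (\<Sum>l | distinct l \<and> set l \<subseteq> S \<and> l \<noteq> [] \<and> hd l = v.
      (- 1) ^ (length l - 1) * (\<Prod>(a, b)\<leftarrow>closed_walk_arcs l. M a b) * set_det M (S - set l))"
    (is "_ = sum ?t ?L")
proof -
  let ?Q = "\<lambda>l. {q. q permutes S - set l}"
  have finL: "finite ?L"
    using finite_distinct_lists_subset[OF assms(1)] .
  \<comment> \<open>\<open>support p v\<close> lists the orbit of \<open>v\<close> under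
    \<open>p\<close> from \<open>v\<close> on, so \<open>?s p\<close> is the cycle factor and
    \<open>?r p\<close> the remaining one.\<close>
  let ?s = "\<lambda>p. support p v"
  let ?r = "\<lambda>p y. if y \<in> S - set (?s p) then p y else y"
  have decomp: "cycle_of_list (?s p) \<circ> ?r p = p" if pS: "p permutes S" for p
  proof
    fix a
    have is_permutation: "permutation p"
      using pS assms(1) permutation_permutes by blast
    show "(cycle_of_list (?s p) \<circ> ?r p) a = p a"
    proof -
      consider "a \<in> S - set (?s p)" | "a \<in> set (?s p)" | "a \<notin> S" "a \<notin> set (?s p)"
        by blast
      thus ?thesis
      proof cases
        case 1
        have "?r p a \<in> S - set (?s p)"
          using permutes_in_image[OF semidecomposition[OF pS assms(1)]] 1 by blast
        hence "p a \<in> S - set (?s p)"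
          using 1 by presburger
        thus ?thesis
          using 1 id_outside_supp[of _ "?s p"] by simp
      next
        case 2
        thus ?thesis using cycle_restrict[OF is_permutation] by simp
      next
        case 3
        thus ?thesis using id_outside_supp[OF 3(2)] permutes_not_in[OF pS] by fastforce
      qed
    qed
  qed
  have "set_det M S = (\<Sum>(l, q)\<in>(SIGMA l:?L. ?Q l).
      of_int (sign (cycle_of_list l \<circ> q)) * (\<Prod>i\<in>S. M i ((cycle_of_list l \<circ> q) i)))"
    unfolding set_det_def
  proof (rule sum.reindex_bij_witness[where
        i = "\<lambda>(l, q). cycle_of_list l \<circ> q" and j = "\<lambda>p. (?s p, ?r p)"], goal_cases)
    case (1 p)
    hence "p permutes S" by simp
    thus ?case by (simp only: case_prod_conv decomp)
  next
    case (2 p)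
    hence pS: "p permutes S" by simp
    hence is_permutation: "permutation p"
      using assms(1) permutation_permutes by blast
    have "(p ^^ i) v \<in> S" for i
      using v permutes_in_image[OF permutes_funpow[OF pS]] by simp
    moreover have "least_power p v > 0"
      using least_power_of_permutation(2)[OF is_permutation] .
    moreover have "distinct (?s p)"
      using cycle_of_permutation[OF is_permutation] .
    moreover have "?r p permutes S - set (?s p)"
      using semidecomposition[OF pS assms(1)] .
    moreover have "hd (?s p) = v"
      using \<open>least_power p v > 0\<close> by (simp add: hd_map)
    ultimately show ?case by (auto simp del: distinct_map)
  next
    case (3 lq)
    obtain l q where lq: "lq = (l, q)" by fastforce
    with 3 have l: "distinct l" "l \<noteq> []" "hd l = v" and q: "q permutes S - set l"
      by auto
    have s: "?s (cycle_of_list l \<circ> q) = l"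
      using support_cycle_comp[OF l(1,2) q] l(3) by simp
    have "?r (cycle_of_list l \<circ> q) = q"
      unfolding s
    proof
      fix y
      show "(if y \<in> S - set l then (cycle_of_list l \<circ> q) y else y) = q y"
        using permutes_in_image[OF q, of y] permutes_not_in[OF q, of y]
          id_outside_supp[of "q y" l] by auto
    qed
    with s show ?case by (simp only: lq case_prod_conv)
  next
    case (4 lq)
    obtain l q where lq: "lq = (l, q)" by fastforce
    with 4 have l: "set l \<subseteq> S" and q: "q permutes S - set l"
      by auto
    have "cycle_of_list l permutes S" "q permutes S"
      using permutes_subset[OF cycle_permutes l] permutes_subset[OF q] by auto
    thus ?case
      by (simp add: lq permutes_compose)
  next
    case (5 p)
    hence "p permutes S" by simp
    thus ?case by (simp only: case_prod_conv decomp)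
  qed
  also have "\<dots> = (\<Sum>l\<in>?L. \<Sum>q\<in>?Q l. of_int (sign (cycle_of_list l \<circ> q)) *
      (\<Prod>i\<in>S. M i ((cycle_of_list l \<circ> q) i)))"
    using finL assms(1) by (intro sum.Sigma[symmetric]) (auto simp: finite_permutations)
  also have "\<dots> = sum ?t ?L"
  proof (rule sum.cong[OF refl])
    fix l assume "l \<in> ?L"
    hence l: "distinct l" "set l \<subseteq> S" by auto
    have "of_int (sign (cycle_of_list l \<circ> q)) * (\<Prod>i\<in>S. M i ((cycle_of_list l \<circ> q) i)) =
        (- 1) ^ (length l - 1) * (\<Prod>(a, b)\<leftarrow>closed_walk_arcs l. M a b) *
        (of_int (sign q) * (\<Prod>i\<in>S - set l. M i (q i)))" if q: "q permutes S - set l" for q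
    proof -
      have "permutation q"
        using q assms(1) permutation_permutes finite_Diff by blast
      hence sign: "sign (cycle_of_list l \<circ> q) = (- 1) ^ (length l - 1) * sign q"
        by (simp add: sign_compose permutation_of_cycle sign_cycle_of_list[OF l(1)])
      have "(\<Prod>i\<in>S. M i ((cycle_of_list l \<circ> q) i)) =
          (\<Prod>i\<in>set l. M i ((cycle_of_list l \<circ> q) i)) *
          (\<Prod>i\<in>S - set l. M i ((cycle_of_list l \<circ> q) i))"
        using prod.subset_diff[OF l(2) assms(1)] by (simp add: mult.commute)
      also have "(\<Prod>i\<in>set l. M i ((cycle_of_list l \<circ> q) i)) =
          (\<Prod>i\<in>set l. M i (cycle_of_list l i))"
        by (intro prod.cong refl) (simp add: permutes_not_in[OF q])
      also have "\<dots> = (\<Prod>i\<leftarrow>l. M i (cycle_of_list l i))"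
        using l(1) by (simp add: prod.distinct_set_conv_list)
      also have "map (\<lambda>i. M i (cycle_of_list l i)) l =
          map (\<lambda>(a, b). M a b) (zip l (map (cycle_of_list l) l))"
        by (simp add: zip_map2 zip_same_conv_map)
      also have "\<dots> = map (\<lambda>(a, b). M a b) (closed_walk_arcs l)"
        by (simp add: map_cycle_of_list[OF l(1)] closed_walk_arcs_def)
      also have "(\<Prod>i\<in>S - set l. M i ((cycle_of_list l \<circ> q) i)) = (\<Prod>i\<in>S - set l. M i (q i))"
      proof (intro prod.cong refl)
        fix i assume "i \<in> S - set l"
        hence "q i \<notin> set l"
          using permutes_in_image[OF q] by auto
        thus "M i ((cycle_of_list l \<circ> q) i) = M i (q i)"
          by (simp add: id_outside_supp)
      qed
      finally show ?thesis
        by (simp add: sign algebra_simps)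
    qed
    thus "(\<Sum>q\<in>?Q l. of_int (sign (cycle_of_list l \<circ> q)) *
        (\<Prod>i\<in>S. M i ((cycle_of_list l \<circ> q) i))) = ?t l"
      by (simp add: set_det_def sum_distrib_left)
  qed
  finally show ?thesis .
qed

section \<open>Traversals of cycles\<close>

text \<open>The determinant meets closed walks with a direction and a starting point, whereas
  \<open>cycle_gain\<close> belongs to an undirected cycle through a chosen traversal; this version
  makes the two comparable.\<close>

definition walk_gain :: "('a \<times> 'a \<Rightarrow> complex) \<Rightarrow> 'a list \<Rightarrow> complex" where
  "walk_gain \<phi> l = prod_list (map \<phi> (closed_walk_arcs l))"

lemma closed_walk_arcs_rotate: "closed_walk_arcs (rotate n l) = rotate n (closed_walk_arcs l)"
proof (induction n)
  case (Suc n)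
  have "zip (rotate1 xs) (rotate1 ys) = rotate1 (zip xs ys)" if "length xs = length ys"
    for xs ys :: "'a list"
    using that by (cases xs; cases ys) auto
  thus ?case using Suc by (simp add: closed_walk_arcs_def)
qed (simp add: closed_walk_arcs_def)

text \<open>\<open>rev (rotate1 l)\<close> runs backwards along the closed walk \<open>l\<close> from the same starting vertex.\<close>

lemma rotate1_rev_rotate1: "rotate1 (rev (rotate1 l)) = rev l"
  by (cases l) auto

lemma closed_walk_arcs_reverse:
  "closed_walk_arcs (rev (rotate1 l)) = map prod.swap (rev (closed_walk_arcs l))"
proof -
  have "closed_walk_arcs (rev (rotate1 l)) = rev (zip (rotate1 l) l)"
    by (simp add: closed_walk_arcs_def rotate1_rev_rotate1 zip_rev)
  also have "zip (rotate1 l) l = map prod.swap (zip l (rotate1 l))"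
    by (subst zip_commute) (auto simp: prod.swap_def case_prod_unfold)
  finally show ?thesis
    by (simp add: closed_walk_arcs_def rev_map)
qed

lemma set_closed_walk_arcs:
  "set (closed_walk_arcs l) = {(l ! i, l ! (Suc i mod length l)) | i. i < length l}"
  by (auto simp: closed_walk_arcs_def set_zip nth_rotate1)

lemma hd_reverse [simp]: "hd (rev (rotate1 l)) = hd l"
  by (cases l) auto

lemma nth_reverse_1:
  assumes "2 \<le> length l"
  shows "rev (rotate1 l) ! 1 = l ! (length l - 1)"
proof -
  have "Suc (length l - Suc (Suc 0)) = length l - 1"
    using assms by simp
  thus ?thesis
    using assms by (simp add: rev_nth nth_rotate1 del: Suc_diff_Suc)
qed

lemma traverses_rotate: "traverses l C \<Longrightarrow> traverses (rotate n l) C"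
  by (simp add: traverses_def closed_walk_arcs_rotate)

lemma traverses_reverse: "traverses l C \<Longrightarrow> traverses (rev (rotate1 l)) C"
  by (auto simp: traverses_def closed_walk_arcs_reverse)

lemma walk_gain_rotate: "walk_gain \<phi> (rotate n l) = walk_gain \<phi> l"
proof (induction n)
  case (Suc n)
  have "prod_list (rotate1 xs) = prod_list xs" for xs :: "complex list"
    by (cases xs) auto
  thus ?case
    using Suc by (simp add: walk_gain_def closed_walk_arcs_rotate rotate1_map[symmetric]
        del: rotate_Suc) (simp add: rotate1_map[symmetric])
qed simp

lemma is_cycle_verts:
  assumes "is_cycle C"
  shows "pverts C = fst ` parcs C" and "parcs C \<subseteq> pverts C \<times> pverts C"
    and "pverts C \<noteq> {}" and "finite (pverts C)" and "sym (parcs C)"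
proof -
  obtain l where l: "traverses l C"
    using assms by (auto simp: is_cycle_def)
  have "map fst (closed_walk_arcs l) = l"
    by (simp add: closed_walk_arcs_def)
  hence fst: "fst ` set (closed_walk_arcs l) = set l"
    by (metis set_map)
  have sub: "set (closed_walk_arcs l) \<subseteq> set l \<times> set l"
    by (auto simp: closed_walk_arcs_def dest: set_zip_leftD set_zip_rightD)
  show "pverts C = fst ` parcs C"
    using l fst sub by (force simp: traverses_def image_Un)
  show "parcs C \<subseteq> pverts C \<times> pverts C"
    using l sub by (auto simp: traverses_def)
  show "pverts C \<noteq> {}" "finite (pverts C)" "sym (parcs C)"
    using l by (auto simp: traverses_def sym_def)
qed

lemma traverses_at_vertex:
  assumes "traverses l C" "v \<in> pverts C"
  obtains n where "hd (rotate n l) = v"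
proof -
  obtain n where "n < length l" "l ! n = v"
    using assms by (auto simp: traverses_def in_set_conv_nth)
  hence "hd (rotate n l) = v"
    by (subst hd_rotate_conv_nth) auto
  thus ?thesis by (rule that)
qed

text \<open>An arc of the walk at \<open>m ! j\<close> either starts there and leads to the
  successor, or ends there and comes from the predecessor; distinctness fixes the index. The
  conditionals spell out the wrap-around at both ends.\<close>

lemma closed_walk_neighbour:
  assumes "distinct m" "j < length m"
    and "(m ! j, y) \<in> set (closed_walk_arcs m) \<union> (set (closed_walk_arcs m))\<inverse>"
  shows "y = m ! (if Suc j = length m then 0 else Suc j) \<or>
    y = m ! ((if j = 0 then length m else j) - 1)"
proof -
  consider "y = m ! (Suc j mod length m)" | i where "i < length m" "y = m ! i" "m ! j = m ! (Suc i mod length m)"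
    using assms by (auto simp: set_closed_walk_arcs nth_eq_iff_index_eq)
  thus ?thesis
  proof cases
    case 1
    thus ?thesis using assms(2) by (auto simp: mod_Suc)
  next
    case (2 i)
    have "Suc i mod length m < length m"
      using assms(2) by (intro mod_less_divisor) auto
    hence "j = Suc i mod length m"
      using 2 assms by (simp add: nth_eq_iff_index_eq)
    hence "i = (if j = 0 then length m else j) - 1"
      using 2(1) by (auto simp: mod_Suc split: if_splits)
    thus ?thesis using 2(2) by simp
  qed
qed

text \<open>Once the first step agrees, \<open>l\<close> can leave \<open>m\<close> only by turning back, which distinctness forbids.\<close>

lemma closed_walk_eqI:
  assumes l: "distinct l" "3 \<le> length l" and m: "distinct m" "3 \<le> length m"
    and sub: "set (closed_walk_arcs l) \<subseteq> set (closed_walk_arcs m) \<union> (set (closed_walk_arcs m))\<inverse>"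
    and start: "l ! 0 = m ! 0" "l ! 1 = m ! 1"
  shows "l = m"
proof -
  let ?k = "length l" and ?n = "length m"
  have arcs: "(l ! i, l ! (Suc i mod ?k)) \<in> set (closed_walk_arcs m) \<union> (set (closed_walk_arcs m))\<inverse>"
    if "i < ?k" for i
    using sub that by (auto simp: set_closed_walk_arcs)
  have "set l \<subseteq> set m"
  proof
    fix x assume "x \<in> set l"
    then obtain i where "i < ?k" "x = l ! i"
      by (auto simp: in_set_conv_nth)
    thus "x \<in> set m"
      using arcs[of i] by (auto simp: closed_walk_arcs_def dest: set_zip_leftD set_zip_rightD)
  qed
  hence le: "?k \<le> ?n"
    using l(1) m(1) by (metis card_mono distinct_card List.finite_set)
  have eq: "l ! i = m ! i" if "i < ?k" for i
    using that
  proof (induction i rule: less_induct)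
    case (less i)
    consider "i = 0" | "i = 1" | j where "i = Suc (Suc j)"
      by (metis One_nat_def not0_implies_Suc)
    thus ?case
    proof cases
      case (3 j)
      have IH: "l ! j = m ! j" "l ! Suc j = m ! Suc j"
        using less 3 by auto
      have "(m ! Suc j, l ! i) \<in> set (closed_walk_arcs m) \<union> (set (closed_walk_arcs m))\<inverse>"
        using arcs[of "Suc j"] less.prems 3 IH by simp
      hence "l ! i = m ! i \<or> l ! i = m ! j"
        using closed_walk_neighbour[OF m(1), of "Suc j" "l ! i"] less.prems 3 le
        by auto
      moreover have "l ! i \<noteq> l ! j"
        using l(1) less.prems 3 by (simp add: nth_eq_iff_index_eq)
      ultimately show ?thesis
        using IH(1) by simp
    qed (use start in auto)
  qed
  \<comment> \<open>The closing arc of \<open>l\<close> makes \<open>m ! (?k - 1)\<close> a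
    neighbour of \<open>m ! 0\<close>, so its index is 1 or \<open>?n - 1\<close>; the first is
    excluded by \<open>3 \<le> ?k\<close>.\<close>
  have "?k = ?n"
  proof -
    have "Suc (?k - 1) = ?k"
      using l(2) by arith
    hence "Suc (?k - 1) mod ?k = 0"
      by simp
    hence "(l ! (?k - 1), l ! 0) \<in> set (closed_walk_arcs m) \<union> (set (closed_walk_arcs m))\<inverse>"
      using arcs[of "?k - 1"] l(2) by simp
    hence "(m ! 0, m ! (?k - 1)) \<in> set (closed_walk_arcs m) \<union> (set (closed_walk_arcs m))\<inverse>"
      using eq[of "?k - 1"] start l(2) by auto
    hence "m ! (?k - 1) = m ! 1 \<or> m ! (?k - 1) = m ! (?n - 1)"
      using closed_walk_neighbour[OF m(1), of 0 "m ! (?k - 1)"] m(2) by (cases m) auto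
    hence "?k - 1 = 1 \<or> ?k - 1 = ?n - 1"
      using m le l(2) by (simp add: nth_eq_iff_index_eq)
    thus ?thesis using l(2) le by auto
  qed
  with eq show ?thesis
    by (intro nth_equalityI) auto
qed

text \<open>The common first vertex has two neighbours on \<open>C\<close>, so the second vertex of
  \<open>l\<close> selects \<open>m\<close> or its reverse, and the rest of the walk is forced.
  Assuming only an inclusion of arcs lets this serve both for counting traversals and for comparing
  two cycles.\<close>

lemma traverses_eq_or_reverse:
  assumes l: "traverses l D" and m: "traverses m C"
    and sub: "parcs D \<subseteq> parcs C" and hd: "hd l = hd m"
  shows "l = m \<or> l = rev (rotate1 m)"
proof -
  let ?n = "length m"
  let ?m = "rev (rotate1 m)"
  have m': "traverses ?m C"
    using traverses_reverse[OF m] .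
  have ne: "l \<noteq> []" "m \<noteq> []" "?m \<noteq> []"
    using l m by (auto simp: traverses_def)
  have l0: "l ! 0 = m ! 0" "l ! 0 = ?m ! 0"
    using hd hd_reverse[of m] ne by (simp_all add: hd_conv_nth del: hd_reverse)
  have m1: "?m ! 1 = m ! (?n - 1)"
    using m by (intro nth_reverse_1) (auto simp: traverses_def)
  have "(l ! 0, l ! (Suc 0 mod length l)) \<in> set (closed_walk_arcs l)"
    using ne(1) unfolding set_closed_walk_arcs by blast
  hence "(l ! 0, l ! 1) \<in> set (closed_walk_arcs l)"
    using l by (simp add: traverses_def)
  hence "(m ! 0, l ! 1) \<in> set (closed_walk_arcs m) \<union> (set (closed_walk_arcs m))\<inverse>"
    using l m sub l0 by (auto simp: traverses_def)
  hence "l ! 1 = m ! 1 \<or> l ! 1 = ?m ! 1"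
    unfolding m1 using closed_walk_neighbour[of m 0 "l ! 1"] m ne(2) by (auto simp: traverses_def)
  thus ?thesis
  proof
    assume "l ! 1 = m ! 1"
    hence "l = m"
      using l m sub l0 by (intro closed_walk_eqI) (auto simp: traverses_def)
    thus ?thesis ..
  next
    assume "l ! 1 = ?m ! 1"
    hence "l = ?m"
      using l m' sub l0 by (intro closed_walk_eqI) (auto simp: traverses_def)
    thus ?thesis ..
  qed
qed

text \<open>Once a traversal of \<open>C\<close> is rotated to the start of one of \<open>D\<close>,
  the latter must be it or its reverse, and so runs around all of \<open>C\<close>.\<close>

lemma cycle_subset_eq:
  assumes "is_cycle D" "is_cycle C" "parcs D \<subseteq> parcs C"
  shows "D = C"
proof -
  obtain l m where l: "traverses l D" and m: "traverses m C"
    using assms by (auto simp: is_cycle_def)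
  have "l \<noteq> []"
    using l by (auto simp: traverses_def)
  hence "hd l \<in> pverts D"
    using l by (simp add: traverses_def)
  hence "hd l \<in> pverts C"
    using is_cycle_verts(1)[OF assms(1)] is_cycle_verts(1)[OF assms(2)] assms(3) by auto
  then obtain n where "hd (rotate n m) = hd l"
    using traverses_at_vertex[OF m] by metis
  then have "l = rotate n m \<or> l = rev (rotate1 (rotate n m))"
    using traverses_eq_or_reverse[OF l traverses_rotate[OF m] assms(3)] by simp
  hence "traverses l C"
    using traverses_rotate[OF m] traverses_reverse by blast
  thus ?thesis
    using l by (simp add: traverses_def)
qed

text \<open>Gains have modulus 1, so inverting them is conjugating them. Reversing a walk inverts
  each gain, and the order of the factors is immaterial.\<close>

lemma (in gain_graph) walk_gain_reverse:
  assumes "set (closed_walk_arcs l) \<subseteq> parcs G"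
  shows "walk_gain \<phi> (rev (rotate1 l)) = cnj (walk_gain \<phi> l)"
proof -
  have "\<phi> (prod.swap e) = cnj (\<phi> e)" if "e \<in> parcs G" for e
  proof -
    obtain p q where e: "e = (p, q)" by fastforce
    hence "\<phi> (q, p) = inverse (\<phi> (p, q))"
      using gain_reverse[OF arcs_symmetric[of p q]] that by simp
    moreover have "\<phi> e * cnj (\<phi> e) = 1"
      using complex_norm_square[of "\<phi> e"] gain_unit[OF that] by simp
    ultimately show ?thesis
      using inverse_unique[of "\<phi> e"] e by simp
  qed
  hence "map (\<phi> \<circ> prod.swap) (closed_walk_arcs l) = map (cnj \<circ> \<phi>) (closed_walk_arcs l)"
    using assms by auto
  moreover have "prod_list (map (cnj \<circ> \<phi>) es) = cnj (prod_list (map \<phi> es))" for es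
    by (induction es) auto
  moreover have "prod_list (rev xs) = prod_list xs" for xs :: "complex list"
    by (induction xs) (auto simp: mult.commute)
  ultimately show ?thesis
    by (simp add: walk_gain_def closed_walk_arcs_reverse rev_map[symmetric] del: map_eq_conv)
qed

text \<open>Exactly two traversals start at \<open>v\<close>, and z + cnj z = 2 Re z is the origin
  of both the factor 2 and the real part.\<close>

lemma (in gain_graph) sum_walk_gain_traversals:
  assumes C: "is_cycle C" "parcs C \<subseteq> parcs G" and v: "v \<in> pverts C"
  shows "(\<Sum>l | traverses l C \<and> hd l = v. walk_gain \<phi> l) = of_real (2 * Re (cycle_gain \<phi> C))"
proof -
  define m where "m = (SOME l. traverses l C)"
  have "traverses m C"
    using C(1) unfolding m_def is_cycle_def by (rule someI_ex)
  then obtain n where n: "hd (rotate n m) = v"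
    using traverses_at_vertex v by metis
  define l where "l = rotate n m"
  have l: "traverses l C" "hd l = v"
    using traverses_rotate[OF \<open>traverses m C\<close>] n by (auto simp: l_def)
  have gain: "walk_gain \<phi> l = cycle_gain \<phi> C"
    by (simp add: l_def walk_gain_rotate) (simp add: cycle_gain_def walk_gain_def m_def)
  \<comment> \<open>The second vertex of the reverse is the last vertex of \<open>l\<close>. As the
    length is at least 3, it is not \<open>l ! 1\<close>, and the two traversals differ.\<close>
  have "rev (rotate1 l) ! 1 \<noteq> l ! 1"
    using l(1) by (subst nth_reverse_1) (auto simp: traverses_def nth_eq_iff_index_eq)
  hence ne: "l \<noteq> rev (rotate1 l)"
    by metis
  have "{l. traverses l C \<and> hd l = v} = {l, rev (rotate1 l)}"
    using traverses_eq_or_reverse[OF _ l(1)] l traverses_reverse[OF l(1)] by auto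
  moreover have "walk_gain \<phi> (rev (rotate1 l)) = cnj (walk_gain \<phi> l)"
    using l(1) C(2) by (intro walk_gain_reverse) (auto simp: traverses_def)
  ultimately show ?thesis
    using ne by (simp add: gain complex_add_cnj)
qed

text \<open>Every vertex of a cycle is the tail of one of its arcs, so inclusion of the arcs already
  forces inclusion of the vertices.\<close>

lemma cycles_of_iff:
  assumes "pair_wf_digraph G"
  shows "C \<in> cycles_of G \<longleftrightarrow> is_cycle C \<and> parcs C \<subseteq> parcs G"
proof -
  interpret pair_wf_digraph G by fact
  have "pair_wf_digraph C" if "is_cycle C"
    using is_cycle_verts(2)[OF that] by unfold_locales auto
  moreover have "pverts C \<subseteq> pverts G" if "is_cycle C" "parcs C \<subseteq> parcs G"
    unfolding is_cycle_verts(1)[OF that(1)] using that(2) by (auto dest!: subsetD intro: in_arcsD1)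
  ultimately show ?thesis
    using assms by (auto simp: cycles_of_def subgraph_def compatible_def wf_digraph_wp_iff)
qed

lemma (in pair_graph) finite_cycles_of: "finite (cycles_of G)"
proof (rule finite_subset)
  show "cycles_of G \<subseteq> (\<lambda>(V, A). \<lparr>pverts = V, parcs = A\<rparr>) ` (Pow (pverts G) \<times> Pow (parcs G))"
  proof
    fix C assume "C \<in> cycles_of G"
    hence "pverts C \<subseteq> pverts G" "parcs C \<subseteq> parcs G"
      by (auto simp: cycles_of_def subgraph_def)
    thus "C \<in> (\<lambda>(V, A). \<lparr>pverts = V, parcs = A\<rparr>) ` (Pow (pverts G) \<times> Pow (parcs G))"
      by (intro image_eqI[where x = "(pverts C, parcs C)"]) auto
  qed
qed (use pair_finite_verts pair_finite_arcs in simp)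

text \<open>Walks are grouped by the cycle that they traverse. Both directions see the same vertex
  set, so \<open>f\<close> comes out of each group; it will be the determinant on the remaining
  vertices.\<close>

lemma (in gain_graph) sum_closed_walks_eq_sum_cycles:
  fixes f :: "'a set \<Rightarrow> complex poly"
  shows "(\<Sum>l | distinct l \<and> 3 \<le> length l \<and> hd l = v \<and> set (closed_walk_arcs l) \<subseteq> parcs G.
      Polynomial.smult (walk_gain \<phi> l) (f (set l))) =
    (\<Sum>C | C \<in> cycles_of G \<and> v \<in> pverts C.
      Polynomial.smult (of_real (2 * Re (cycle_gain \<phi> C))) (f (pverts C)))"
    (is "sum ?t ?L = sum ?u ?\<C>")
proof -
  let ?T = "\<lambda>C. {l. traverses l C \<and> hd l = v}"
  let ?C = "\<lambda>l. \<lparr>pverts = set l, parcs = set (closed_walk_arcs l) \<union> (set (closed_walk_arcs l))\<inverse>\<rparr>"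
  have wf: "pair_wf_digraph G" ..
  have "sum ?t ?L = (\<Sum>(C, l)\<in>(SIGMA C:?\<C>. ?T C). ?t l)"
  proof (rule sum.reindex_bij_witness[where i = snd and j = "\<lambda>l. (?C l, l)"], goal_cases)
    case (2 l)
    hence "traverses l (?C l)"
      by (simp add: traverses_def)
    moreover have "?C l \<in> cycles_of G"
      using 2 calculation arcs_symmetric by (auto simp: cycles_of_iff[OF wf] is_cycle_def)
    moreover have "v \<in> set l"
      using 2 hd_in_set[of l] by fastforce
    ultimately show ?case
      using 2 by simp
  qed (auto simp: traverses_def cycles_of_iff[OF wf] intro: pair_pre_digraph.equality)
  also have "\<dots> = (\<Sum>C\<in>?\<C>. \<Sum>l\<in>?T C. ?t l)"
  proof (rule sum.Sigma[symmetric])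
    show "\<forall>C\<in>?\<C>. finite (?T C)"
    proof
      fix C assume "C \<in> ?\<C>"
      hence "finite (pverts C)"
        using is_cycle_verts(4) by (auto simp: cycles_of_def)
      thus "finite (?T C)"
        by (rule finite_subset[OF _ finite_subset_distinct, rotated]) (auto simp: traverses_def)
    qed
  qed (use finite_cycles_of in simp)
  also have "\<dots> = sum ?u ?\<C>"
  proof (rule sum.cong[OF refl])
    fix C assume C: "C \<in> ?\<C>"
    have "(\<Sum>l\<in>?T C. ?t l) = (\<Sum>l\<in>?T C. Polynomial.smult (walk_gain \<phi> l) (f (pverts C)))"
      by (intro sum.cong refl) (simp add: traverses_def)
    also have "\<dots> = Polynomial.smult (\<Sum>l\<in>?T C. walk_gain \<phi> l) (f (pverts C))"
      by (simp add: smult_sum)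
    also have "(\<Sum>l\<in>?T C. walk_gain \<phi> l) = of_real (2 * Re (cycle_gain \<phi> C))"
      using C by (intro sum_walk_gain_traversals) (auto simp: cycles_of_iff[OF wf])
    finally show "(\<Sum>l\<in>?T C. ?t l) = ?u C" .
  qed
  finally show ?thesis .
qed

section \<open>Packing polynomials\<close>

text \<open>The map \<open>s\<close> gives the vertices that a member covers. One notion thus serves
  for matchings (\<open>s = id\<close>), disjoint cycles (\<open>s = pverts\<close>) and mixtures of
  the two (\<open>s = piece_verts\<close>).\<close>

definition packings :: "('e \<Rightarrow> 'a set) \<Rightarrow> 'e set \<Rightarrow> 'e set set" where
  "packings s X = {P. P \<subseteq> X \<and> pairwise (\<lambda>C D. disjnt (s C) (s D)) P}"

lemma packings_empty: "packings s {} = {{}}"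
  by (auto simp: packings_def)

lemma pair_mem_packingsD:
  assumes "P \<in> packings s X" "d \<in> P" "e \<in> P" "v \<in> s d" "v \<in> s e"
  shows "d = e"
proof (rule ccontr)
  assume "d \<noteq> e"
  hence "disjnt (s d) (s e)"
    using assms(1-3) unfolding packings_def pairwise_def by blast
  thus False
    using assms(4,5) by (auto simp: disjnt_def)
qed

lemma finite_packings: "finite X \<Longrightarrow> finite (packings s X)"
  by (rule finite_subset[of _ "Pow X"]) (auto simp: packings_def)

text \<open>Since \<open>s e\<close> contains \<open>v\<close>, it is not disjoint from itself, so
  the restriction on the right excludes \<open>e\<close>; this accounts for
  \<open>e \<notin> P\<close> on the left.\<close>

lemma insert_mem_packings_iff:
  assumes "v \<in> s e" "e \<in> X"
  shows "insert e P \<in> packings s X \<and> e \<notin> P \<longleftrightarrow> P \<in> packings s {d \<in> X. disjnt (s d) (s e)}"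
proof -
  have "\<not> disjnt (s e) (s e)"
    using assms(1) by (auto simp: disjnt_def)
  thus ?thesis
    unfolding packings_def mem_Collect_eq pairwise_insert using assms(2)
    by (blast intro: disjnt_sym)
qed

text \<open>Disjointness lets at most one member cover \<open>v\<close>; removing that member leaves
  an arbitrary packing by members disjoint from it.\<close>

lemma sum_packings_split:
  assumes "finite X"
  shows "(\<Sum>P\<in>packings s X. f P) = (\<Sum>P\<in>packings s {d \<in> X. disjnt (s d) {v}}. f P) +
    (\<Sum>e | e \<in> X \<and> v \<in> s e. \<Sum>P\<in>packings s {d \<in> X. disjnt (s d) (s e)}. f (insert e P))"
proof -
  let ?A = "packings s {d \<in> X. disjnt (s d) {v}}"
  let ?B = "{P \<in> packings s X. \<exists>e\<in>P. v \<in> s e}"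
  let ?Q = "\<lambda>e. packings s {d \<in> X. disjnt (s d) (s e)}"
  \<comment> \<open>On packings that cover \<open>v\<close> the choice is forced, as
    \<open>c_insert\<close> shows.\<close>
  define c where "c = (\<lambda>P. SOME e. e \<in> P \<and> v \<in> s e)"
  have c: "c P \<in> P" "v \<in> s (c P)" if "P \<in> ?B" for P
    using someI_ex[of "\<lambda>e. e \<in> P \<and> v \<in> s e"] that by (auto simp: c_def)
  have c_insert: "c (insert e P) = e" if "insert e P \<in> packings s X" "v \<in> s e" for e P
  proof -
    have "insert e P \<in> ?B"
      using that by auto
    from pair_mem_packingsD[OF that(1) c(1)[OF this] _ c(2)[OF this] that(2)] show ?thesis
      by simp
  qed
  have eq: "packings s X = ?A \<union> ?B" and disj: "?A \<inter> ?B = {}"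
    by (auto simp: packings_def)
  have "finite ?A" "finite ?B"
    using assms by (simp_all add: finite_packings)
  hence "(\<Sum>P\<in>packings s X. f P) = sum f ?A + sum f ?B"
    by (subst eq) (rule sum.union_disjoint[OF _ _ disj])
  also have "sum f ?B = (\<Sum>(e, P)\<in>(SIGMA e:{e \<in> X. v \<in> s e}. ?Q e). f (insert e P))"
  proof (rule sum.reindex_bij_witness[where
        i = "\<lambda>(e, P). insert e P" and j = "\<lambda>P. (c P, P - {c P})"], goal_cases)
    case (1 P)
    thus ?case using c(1)[OF 1] by (simp add: insert_absorb)
  next
    case (2 P)
    have "c P \<in> X"
      using 2 c(1)[OF 2] by (auto simp: packings_def)
    moreover have "insert (c P) (P - {c P}) \<in> packings s X"
      using c(1)[OF 2] 2 by (simp add: insert_absorb)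
    ultimately have "P - {c P} \<in> ?Q (c P)"
      using insert_mem_packings_iff[of v s "c P" X "P - {c P}"] c(2)[OF 2] by simp
    thus ?case
      using c(2)[OF 2] \<open>c P \<in> X\<close> by simp
  next
    case (3 eP)
    obtain e P where eP: "eP = (e, P)" by fastforce
    hence "insert e P \<in> packings s X" "e \<notin> P" "v \<in> s e"
      using 3 insert_mem_packings_iff[of v s e X P] by simp_all
    thus ?case
      by (simp add: eP c_insert)
  next
    case (4 eP)
    obtain e P where eP: "eP = (e, P)" by fastforce
    thus ?case
      using 4 insert_mem_packings_iff[of v s e X P] by simp
  next
    case (5 P)
    thus ?case using c(1)[OF 5] by (simp add: insert_absorb)
  qed
  also have "\<dots> = (\<Sum>e | e \<in> X \<and> v \<in> s e. \<Sum>P\<in>?Q e. f (insert e P))"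
    using assms finite_packings[of _ s] by (intro sum.Sigma[symmetric]) auto
  finally show ?thesis .
qed

definition packing_poly ::
    "('e \<Rightarrow> 'a set) \<Rightarrow> ('e \<Rightarrow> 'b::comm_ring_1) \<Rightarrow> 'e set \<Rightarrow> 'a set \<Rightarrow> 'b poly" where
  "packing_poly s w X V =
    (\<Sum>P\<in>packings s X. monom (\<Prod>e\<in>P. w e) (card (V - (\<Union>e\<in>P. s e))))"

lemma packing_poly_rec:
  assumes X: "finite X" and V: "finite V" "v \<in> V"
  shows "packing_poly s w X V =
    [:0, 1:] * packing_poly s w {d \<in> X. disjnt (s d) {v}} (V - {v}) +
    (\<Sum>e | e \<in> X \<and> v \<in> s e.
      Polynomial.smult (w e) (packing_poly s w {d \<in> X. disjnt (s d) (s e)} (V - s e)))"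
proof -
  let ?f = "\<lambda>V P. monom (\<Prod>e\<in>P. w e) (card (V - (\<Union>e\<in>P. s e)))"
  have "?f V P = [:0, 1:] * ?f (V - {v}) P" if "P \<in> packings s {d \<in> X. disjnt (s d) {v}}" for P
  proof -
    let ?W = "V - {v} - (\<Union>e\<in>P. s e)"
    \<comment> \<open>The vertex \<open>v\<close> stays uncovered and accounts for one factor
      x.\<close>
    have "V - (\<Union>e\<in>P. s e) = insert v ?W"
      using V that by (auto simp: packings_def)
    moreover have "card (insert v ?W) = Suc (card ?W)"
      using V by (intro card_insert_disjoint) auto
    ultimately show ?thesis
      by (simp add: monom_Suc)
  qed
  moreover have "?f V (insert e P) = Polynomial.smult (w e) (?f (V - s e) P)"
    if "e \<in> X" "v \<in> s e" "P \<in> packings s {d \<in> X. disjnt (s d) (s e)}" for e P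
  proof -
    have "e \<notin> P" "P \<subseteq> X"
      using that by (auto simp: packings_def disjnt_def)
    hence "(\<Prod>d\<in>insert e P. w d) = w e * (\<Prod>d\<in>P. w d)"
      using X finite_subset by (intro prod.insert) auto
    moreover have "V - (\<Union>d\<in>insert e P. s d) = V - s e - (\<Union>d\<in>P. s d)"
      by auto
    ultimately show ?thesis
      by (simp only: smult_monom)
  qed
  ultimately show ?thesis
    unfolding packing_poly_def sum_packings_split[OF X, of _ s v] sum_distrib_left smult_sum2
    by (intro arg_cong2[where f = "(+)"] sum.cong refl) auto
qed

lemma vimage_Plus: "(Inl -` R) <+> (Inr -` R) = R"
proof (rule Set.set_eqI)
  fix x show "x \<in> (Inl -` R) <+> (Inr -` R) \<longleftrightarrow> x \<in> R"
    by (cases x) auto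
qed

text \<open>A mixed packing is obtained by choosing its part \<open>Q\<close> in \<open>B\<close>
  first and then packing what \<open>Q\<close> leaves uncovered by members of \<open>A\<close>. With
  cycles as \<open>B\<close> and edges as \<open>A\<close>, the inner polynomial is that of
  matchings.\<close>

lemma packing_poly_Plus:
  assumes "finite A" "finite B"
  shows "packing_poly (case_sum s t) (case_sum u w) (A <+> B) V =
    (\<Sum>Q\<in>packings t B. Polynomial.smult (\<Prod>e\<in>Q. w e)
      (packing_poly s u {d \<in> A. disjnt (s d) (\<Union>e\<in>Q. t e)} (V - (\<Union>e\<in>Q. t e))))"
proof -
  let ?S = "\<lambda>Q. packings s {d \<in> A. disjnt (s d) (\<Union>e\<in>Q. t e)}"
  have "packing_poly (case_sum s t) (case_sum u w) (A <+> B) V = (\<Sum>(Q, P)\<in>(SIGMA Q:packings t B. ?S Q).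
      monom ((\<Prod>e\<in>Q. w e) * (\<Prod>e\<in>P. u e)) (card (V - (\<Union>e\<in>Q. t e) - (\<Union>e\<in>P. s e))))"
    unfolding packing_poly_def
  proof (rule sum.reindex_bij_witness[where
        i = "\<lambda>(Q, P). P <+> Q" and j = "\<lambda>R. (Inr -` R, Inl -` R)"], goal_cases)
    case (1 R)
    show ?case by (simp add: vimage_Plus)
  next
    case (2 R)
    hence sub: "R \<subseteq> A <+> B"
      and disj: "\<And>d e. d \<in> R \<Longrightarrow> e \<in> R \<Longrightarrow> d \<noteq> e \<Longrightarrow> disjnt (case_sum s t d) (case_sum s t e)"
      by (auto simp only: packings_def pairwise_def)
    have "Inr -` R \<in> packings t B"
      using sub disj[of "Inr _" "Inr _"] by (auto simp: packings_def pairwise_def)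
    moreover have "Inl -` R \<in> packings s A"
      using sub disj[of "Inl _" "Inl _"] by (auto simp: packings_def pairwise_def)
    moreover have "disjnt (s d) (\<Union>e\<in>Inr -` R. t e)" if "d \<in> Inl -` R" for d
      using that disj[of "Inl d" "Inr _"] by auto
    ultimately show ?case
      by (auto simp: packings_def)
  next
    case (3 QP)
    thus ?case by (auto simp: Plus_def)
  next
    case (4 QP)
    obtain Q P where QP: "QP = (Q, P)" by fastforce
    hence "Q \<in> packings t B" "P \<in> ?S Q"
      using 4 by auto
    hence Q: "Q \<subseteq> B" "pairwise (\<lambda>d e. disjnt (t d) (t e)) Q"
      and P: "P \<subseteq> A" "pairwise (\<lambda>d e. disjnt (s d) (s e)) P"
      and PQ: "\<And>d e. d \<in> P \<Longrightarrow> e \<in> Q \<Longrightarrow> disjnt (s d) (t e)"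
      by (auto simp: packings_def)
    have "disjnt (case_sum s t d) (case_sum s t e)" if "d \<in> P <+> Q" "e \<in> P <+> Q" "d \<noteq> e" for d e
      using that Q(2) P(2) PQ PQ[THEN disjnt_sym] by (cases d; cases e) (auto simp: pairwise_def)
    thus ?case
      using Q(1) P(1) by (auto simp: QP packings_def pairwise_def)
  next
    case (5 R)
    have R: "R = (Inl -` R) <+> (Inr -` R)"
      by (simp add: vimage_Plus)
    have "R \<subseteq> A <+> B"
      using 5 by (simp add: packings_def)
    hence fin: "finite (Inl -` R)" "finite (Inr -` R)"
      using assms finite_subset[of "Inl -` R" A] finite_subset[of "Inr -` R" B] by auto
    have "(\<Prod>e\<in>R. case_sum u w e) = (\<Prod>e\<in>Inl -` R. u e) * (\<Prod>e\<in>Inr -` R. w e)"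
      by (subst R) (simp add: prod.Plus[OF fin])
    moreover have UN: "(\<Union>e\<in>R. case_sum s t e) = (\<Union>e\<in>Inr -` R. t e) \<union> (\<Union>e\<in>Inl -` R. s e)"
      by (subst R) (simp add: Plus_def Un_commute del: image_vimage_eq)
    moreover have "V - (\<Union>e\<in>R. case_sum s t e) = V - (\<Union>e\<in>Inr -` R. t e) - (\<Union>e\<in>Inl -` R. s e)"
      unfolding UN by (simp only: Diff_eq Compl_Un Int_assoc)
    ultimately show ?case
      by (simp add: mult.commute)
  qed
  also have "\<dots> = (\<Sum>Q\<in>packings t B. \<Sum>P\<in>?S Q.
      monom ((\<Prod>e\<in>Q. w e) * (\<Prod>e\<in>P. u e)) (card (V - (\<Union>e\<in>Q. t e) - (\<Union>e\<in>P. s e))))"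
    using assms finite_packings[of _ t] finite_packings[of _ s] by (intro sum.Sigma[symmetric]) auto
  finally show ?thesis
    by (simp add: packing_poly_def smult_sum2 smult_monom)
qed

section \<open>Unions of disjoint cycles\<close>

text \<open>On vertex-disjoint families of cycles this is the inverse of \<open>cycles_of\<close>,
  along which the sum over subgraphs is reindexed.\<close>

definition cycle_union :: "'a pair_pre_digraph set \<Rightarrow> 'a pair_pre_digraph" where
  "cycle_union \<C> = \<lparr>pverts = (\<Union>C\<in>\<C>. pverts C), parcs = (\<Union>C\<in>\<C>. parcs C)\<rparr>"

lemma pair_wf_cycle_union:
  assumes "\<And>C. C \<in> \<C> \<Longrightarrow> is_cycle C"
  shows "pair_wf_digraph (cycle_union \<C>)"
proof -
  have "\<exists>C\<in>\<C>. fst e \<in> pverts C \<and> snd e \<in> pverts C" if e: "e \<in> parcs (cycle_union \<C>)" for e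
  proof -
    obtain C where C: "C \<in> \<C>" "e \<in> parcs C"
      using e by (auto simp: cycle_union_def)
    thus ?thesis
      using is_cycle_verts(2)[OF assms[OF C(1)]] by (intro bexI[of _ C]) auto
  qed
  thus ?thesis
    by unfold_locales (simp add: cycle_union_def, blast)+
qed

text \<open>Consecutive arcs of a cycle in the union share a vertex, which disjoint members cannot
  do. All its arcs therefore lie in one member, and by \<open>cycle_subset_eq\<close> the cycle is
  that member.\<close>

lemma cycles_of_cycle_union:
  assumes cyc: "\<And>C. C \<in> \<C> \<Longrightarrow> is_cycle C"
    and disj: "pairwise (\<lambda>C D. disjnt (pverts C) (pverts D)) \<C>"
  shows "cycles_of (cycle_union \<C>) = \<C>"
proof -
  have "D \<in> \<C>" if D: "is_cycle D" and sub: "parcs D \<subseteq> (\<Union>C\<in>\<C>. parcs C)" for D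
  proof -
    obtain l where l: "traverses l D"
      using D by (auto simp: is_cycle_def)
    let ?k = "length l"
    have "\<exists>C\<in>\<C>. (l ! i, l ! (Suc i mod ?k)) \<in> parcs C" if "i < ?k" for i
    proof -
      have "(l ! i, l ! (Suc i mod ?k)) \<in> set (closed_walk_arcs l)"
        using that unfolding set_closed_walk_arcs by blast
      thus ?thesis
        using l sub by (auto simp: traverses_def)
    qed
    then obtain c where c: "\<And>i. i < ?k \<Longrightarrow> c i \<in> \<C>"
        "\<And>i. i < ?k \<Longrightarrow> (l ! i, l ! (Suc i mod ?k)) \<in> parcs (c i)"
      by metis
    have in_c: "l ! i \<in> pverts (c i)" "l ! (Suc i mod ?k) \<in> pverts (c i)" if "i < ?k" for i
      using is_cycle_verts(2)[OF cyc] c that by blast+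
    \<comment> \<open>The vertex \<open>l ! Suc i\<close> lies in both \<open>c i\<close> and
      \<open>c (Suc i)\<close>, which disjointness makes equal.\<close>
    have const: "c i = c 0" if "i < ?k" for i
      using that
    proof (induction i)
      case (Suc i)
      hence "l ! Suc i \<in> pverts (c i) \<inter> pverts (c (Suc i))"
        using in_c[of i] in_c[of "Suc i"] by auto
      hence "c (Suc i) = c i"
        using disj c(1)[of i] c(1)[of "Suc i"] Suc.prems by (force simp: pairwise_def disjnt_def)
      with Suc show ?case by simp
    qed simp
    have "set (closed_walk_arcs l) \<subseteq> parcs (c 0)"
    proof
      fix e assume "e \<in> set (closed_walk_arcs l)"
      then obtain i where "i < ?k" "e = (l ! i, l ! (Suc i mod ?k))"
        unfolding set_closed_walk_arcs by blast
      thus "e \<in> parcs (c 0)"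
        using c(2)[of i] const[of i] by simp
    qed
    moreover have "c 0 \<in> \<C>"
      using c(1)[of 0] l by (cases l) (auto simp: traverses_def)
    moreover from this have "sym (parcs (c 0))"
      using is_cycle_verts(5) cyc by blast
    ultimately have "parcs D \<subseteq> parcs (c 0)"
      using l by (auto simp: traverses_def sym_def)
    thus ?thesis
      using cycle_subset_eq[OF D cyc] \<open>c 0 \<in> \<C>\<close> by blast
  qed
  thus ?thesis
    using cyc by (auto simp: cycles_of_iff[OF pair_wf_cycle_union[OF cyc]]) (auto simp: cycle_union_def)
qed

lemma cycle_subgraphsE:
  assumes "K \<in> cycle_subgraphs G"
  obtains \<C> where "\<forall>C\<in>\<C>. is_cycle C"
    "pairwise (\<lambda>C D. disjnt (pverts C) (pverts D)) \<C>" "K = cycle_union \<C>"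
proof -
  obtain \<C> where "\<forall>C\<in>\<C>. is_cycle C" "pairwise (\<lambda>C D. disjnt (pverts C) (pverts D)) \<C>"
      "pverts K = (\<Union>C\<in>\<C>. pverts C)" "parcs K = (\<Union>C\<in>\<C>. parcs C)"
    using assms by (auto simp: cycle_subgraphs_def disjoint_union_of_cycles_def)
  moreover from this have "K = cycle_union \<C>"
    by (simp add: cycle_union_def)
  ultimately show ?thesis
    using that by blast
qed

text \<open>\<open>cycles_of\<close> and \<open>cycle_union\<close> are mutually inverse here; the
  empty family is removed because it would give the subgraph without vertices.\<close>

lemma sum_cycle_subgraphs:
  assumes "pair_wf_digraph G"
  shows "(\<Sum>K\<in>cycle_subgraphs G. f (cycles_of K) (pverts K)) =
    (\<Sum>\<C>\<in>packings pverts (cycles_of G) - {{}}. f \<C> (\<Union>C\<in>\<C>. pverts C))"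
proof (rule sum.reindex_bij_witness[where i = cycle_union and j = cycles_of], goal_cases)
  case (1 K)
  then obtain \<C> where "\<forall>C\<in>\<C>. is_cycle C"
      "pairwise (\<lambda>C D. disjnt (pverts C) (pverts D)) \<C>" "K = cycle_union \<C>"
    by (rule cycle_subgraphsE)
  thus ?case
    by (simp add: cycles_of_cycle_union)
next
  case (2 K)
  then obtain \<C> where \<C>: "\<forall>C\<in>\<C>. is_cycle C"
      "pairwise (\<lambda>C D. disjnt (pverts C) (pverts D)) \<C>" "K = cycle_union \<C>"
    by (rule cycle_subgraphsE)
  have "\<C> \<subseteq> cycles_of G"
  proof
    fix C assume "C \<in> \<C>"
    moreover have "parcs K \<subseteq> parcs G"
      using 2 by (simp add: cycle_subgraphs_def subgraph_def)
    ultimately show "C \<in> cycles_of G"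
      using \<C>(1,3) by (auto simp: cycles_of_iff[OF assms] cycle_union_def)
  qed
  moreover have "\<C> \<noteq> {}"
    using 2 \<C>(3) by (auto simp: cycle_subgraphs_def cycle_union_def)
  ultimately show ?case
    using \<C> by (simp add: packings_def cycles_of_cycle_union)
next
  case (3 \<C>)
  hence "\<And>C. C \<in> \<C> \<Longrightarrow> is_cycle C"
    by (auto simp: packings_def cycles_of_iff[OF assms])
  thus ?case
    using 3 by (simp add: packings_def cycles_of_cycle_union)
next
  case (4 \<C>)
  hence sub: "\<C> \<subseteq> cycles_of G" and ne: "\<C> \<noteq> {}"
    and disj: "pairwise (\<lambda>C D. disjnt (pverts C) (pverts D)) \<C>"
    by (simp_all add: packings_def)
  have cyc: "\<And>C. C \<in> \<C> \<Longrightarrow> is_cycle C"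
    using sub by (auto simp: cycles_of_def)
  have "pverts (cycle_union \<C>) \<subseteq> pverts G" "parcs (cycle_union \<C>) \<subseteq> parcs G"
    using sub by (fastforce simp: cycles_of_def subgraph_def cycle_union_def)+
  hence "subgraph (with_proj (cycle_union \<C>)) (with_proj G)"
    using assms pair_wf_cycle_union[OF cyc]
    by (simp add: subgraph_def compatible_def wf_digraph_wp_iff)
  moreover have "pverts (cycle_union \<C>) \<noteq> {}"
    using ne is_cycle_verts(3)[OF cyc] by (auto simp: cycle_union_def)
  moreover have "disjoint_union_of_cycles (cycle_union \<C>)"
    using cyc disj by (auto simp: disjoint_union_of_cycles_def cycle_union_def)
  ultimately show ?case
    by (simp add: cycle_subgraphs_def)
next
  case (5 K)
  then obtain \<C> where "\<forall>C\<in>\<C>. is_cycle C"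
      "pairwise (\<lambda>C D. disjnt (pverts C) (pverts D)) \<C>" "K = cycle_union \<C>"
    by (rule cycle_subgraphsE)
  thus ?case
    by (simp add: cycles_of_cycle_union) (simp add: cycle_union_def)
qed

section \<open>Matchings and pieces\<close>

lemma (in pair_graph) edges_subset: "e \<in> edges G \<Longrightarrow> e \<subseteq> pverts G"
  by (auto simp: edges_def intro: in_arcsD1 in_arcsD2)

lemma (in pair_graph) card_edge: "e \<in> edges G \<Longrightarrow> card e = 2"
  using no_loops' by (fastforce simp: edges_def)

lemma (in pair_graph) finite_edges: "finite (edges G)"
  by (rule finite_subset[of _ "Pow (pverts G)"]) (use edges_subset pair_finite_verts in auto)

lemma (in pair_graph) matching_poly_eq_packing_poly:
  "(matching_poly G :: 'b::comm_ring_1 poly) = packing_poly id (\<lambda>_. - 1) (edges G) (pverts G)"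
proof -
  let ?n = "card (pverts G)" and ?M = "packings id (edges G)"
  let ?f = "\<lambda>j. monom ((- 1) ^ j) (?n - 2 * j) :: 'b poly"
  \<comment> \<open>Each edge of a matching covers two vertices. The bound places
    \<open>card M\<close> in the range \<open>0..?n div 2\<close>, so that the grouping by size
    misses no matching.\<close>
  have M: "card (pverts G - \<Union>M) = ?n - 2 * card M" "2 * card M \<le> ?n" if "M \<in> ?M" for M
  proof -
    have sub: "M \<subseteq> edges G" and disj: "pairwise disjnt M"
      using that by (auto simp: packings_def)
    have "card (\<Union>M) = sum card M"
      using disj sub edges_subset pair_finite_verts finite_subset
      by (intro card_Union_disjoint) blast+
    also have "\<dots> = (\<Sum>e\<in>M. 2)"
      using sub card_edge by (intro sum.cong) auto
    finally have card: "card (\<Union>M) = 2 * card M"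
      by simp
    have UM: "\<Union>M \<subseteq> pverts G"
      using sub edges_subset by blast
    show "2 * card M \<le> ?n"
      using card_mono[OF pair_finite_verts UM] card by simp
    show "card (pverts G - \<Union>M) = ?n - 2 * card M"
      using card_Diff_subset[OF finite_subset[OF UM pair_finite_verts] UM] card by simp
  qed
  have "(matching_poly G :: 'b poly) = (\<Sum>j\<in>{0..?n div 2}. \<Sum>M | M \<in> ?M \<and> card M = j. ?f (card M))"
    unfolding matching_poly_def Let_def
  proof (rule sum.cong[OF refl])
    fix j
    have "monom ((- 1) ^ j * of_nat (num_matchings G j)) (?n - 2 * j) =
        of_nat (num_matchings G j) * ?f j"
      by (simp add: of_nat_poly smult_monom mult.commute)
    also have "\<dots> = (\<Sum>M | M \<in> ?M \<and> card M = j. ?f j)"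
      by (simp add: num_matchings_def packings_def conj_assoc)
    also have "\<dots> = (\<Sum>M | M \<in> ?M \<and> card M = j. ?f (card M))"
      by (intro sum.cong) auto
    finally show "monom ((- 1) ^ j * of_nat (num_matchings G j)) (?n - 2 * j) =
        (\<Sum>M | M \<in> ?M \<and> card M = j. ?f (card M))" .
  qed
  also have "\<dots> = (\<Sum>M\<in>?M. ?f (card M))"
    using M(2) finite_packings[OF finite_edges] by (intro sum.group) (auto simp: less_eq_div_iff_mult_less_eq mult.commute)
  also have "\<dots> = packing_poly id (\<lambda>_. - 1) (edges G) (pverts G)"
    unfolding packing_poly_def by (intro sum.cong refl) (simp add: M(1))
  finally show ?thesis .
qed

lemma delete_verts_simps [simp]:
  "pverts (delete_verts G S) = pverts G - S"
  "(u, v) \<in> parcs (delete_verts G S) \<longleftrightarrow> (u, v) \<in> parcs G \<and> u \<notin> S \<and> v \<notin> S"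
  by (auto simp: delete_verts_def)

lemma delete_verts_empty [simp]: "delete_verts G {} = G"
  by (simp add: delete_verts_def)

lemma (in gain_graph) gain_graph_delete_verts: "gain_graph (delete_verts G S) \<phi>"
proof -
  have sub: "parcs (delete_verts G S) \<subseteq> parcs G"
    by (auto simp: delete_verts_def)
  hence "finite (parcs (delete_verts G S))"
    using pair_finite_arcs finite_subset by blast
  moreover have "e \<in> parcs (delete_verts G S) \<Longrightarrow> fst e \<in> pverts (delete_verts G S) \<and> snd e \<in> pverts (delete_verts G S)" for e
    using in_arcsD1 in_arcsD2 by (cases e) auto
  moreover have "e \<in> parcs (delete_verts G S) \<Longrightarrow> fst e \<noteq> snd e" for e
    using no_loops' by (cases e) auto
  moreover have "sym (parcs (delete_verts G S))"
    using arcs_symmetric by (auto simp: sym_def)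
  ultimately show ?thesis
    using pair_finite_verts sub gain_unit gain_reverse
    by unfold_locales (auto simp: symmetric_def)
qed

lemma edges_delete_verts: "edges (delete_verts G S) = {e \<in> edges G. disjnt e S}"
  by (fastforce simp: edges_def disjnt_def)

text \<open>As each vertex of a cycle is the tail of one of its arcs, avoiding \<open>S\<close> can
  be tested on the arcs.\<close>

lemma (in gain_graph) cycles_of_delete_verts:
  "cycles_of (delete_verts G S) = {C \<in> cycles_of G. disjnt (pverts C) S}"
proof -
  interpret H: gain_graph "delete_verts G S" \<phi>
    by (rule gain_graph_delete_verts)
  have "parcs C \<subseteq> parcs (delete_verts G S) \<longleftrightarrow> parcs C \<subseteq> parcs G \<and> disjnt (pverts C) S"
    if "is_cycle C" for C
  proof -
    note C = is_cycle_verts(1,2)[OF that]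
    have "pverts C \<inter> S = {} \<longleftrightarrow> parcs C \<subseteq> {(a, b). a \<notin> S \<and> b \<notin> S}"
    proof
      assume "pverts C \<inter> S = {}"
      thus "parcs C \<subseteq> {(a, b). a \<notin> S \<and> b \<notin> S}"
        using C(2) by blast
    next
      assume "parcs C \<subseteq> {(a, b). a \<notin> S \<and> b \<notin> S}"
      thus "pverts C \<inter> S = {}"
        unfolding C(1) by fastforce
    qed
    moreover have "parcs (delete_verts G S) = parcs G \<inter> {(a, b). a \<notin> S \<and> b \<notin> S}"
      by (auto simp: delete_verts_def)
    ultimately show ?thesis
      by (simp add: disjnt_def)
  qed
  hence "C \<in> cycles_of (delete_verts G S) \<longleftrightarrow> C \<in> cycles_of G \<and> disjnt (pverts C) S" for C
    unfolding cycles_of_iff[OF pair_wf_digraph] cycles_of_iff[OF H.pair_wf_digraph] by blast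
  thus ?thesis by blast
qed

section \<open>Mixed packings by edges and cycles\<close>

definition piece_verts :: "'a set + 'a pair_pre_digraph \<Rightarrow> 'a set" where
  "piece_verts = case_sum id pverts"

definition piece_weight :: "('a \<times> 'a \<Rightarrow> complex) \<Rightarrow> 'a set + 'a pair_pre_digraph \<Rightarrow> complex" where
  "piece_weight \<phi> = case_sum (\<lambda>_. - 1) (\<lambda>C. - of_real (2 * Re (cycle_gain \<phi> C)))"

definition pieces :: "'a pair_pre_digraph \<Rightarrow> ('a set + 'a pair_pre_digraph) set" where
  "pieces G = edges G <+> cycles_of G"

lemma (in gain_graph) pieces_delete_verts:
  "pieces (delete_verts G S) = {d \<in> pieces G. disjnt (piece_verts d) S}"
  by (auto simp: pieces_def piece_verts_def edges_delete_verts cycles_of_delete_verts)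

lemma (in pair_graph) finite_pieces: "finite (pieces G)"
  by (simp add: pieces_def finite_edges finite_cycles_of)

abbreviation piece_poly :: "'a pair_pre_digraph \<Rightarrow> ('a \<times> 'a \<Rightarrow> complex) \<Rightarrow> complex poly" where
  "piece_poly G \<phi> \<equiv> packing_poly piece_verts (piece_weight \<phi>) (pieces G) (pverts G)"

lemma (in gain_graph) piece_poly_rec:
  assumes "v \<in> pverts G"
  shows "piece_poly G \<phi> = [:0, 1:] * piece_poly (delete_verts G {v}) \<phi> +
    (\<Sum>d | d \<in> pieces G \<and> v \<in> piece_verts d.
      Polynomial.smult (piece_weight \<phi> d) (piece_poly (delete_verts G (piece_verts d)) \<phi>))"
  using packing_poly_rec[OF finite_pieces pair_finite_verts assms]
  by (simp only: pieces_delete_verts delete_verts_simps)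

text \<open>With the cycles of a packing chosen first, its edges form a matching of the vertices
  left over. Each family of cycles thus contributes its weight times a matching polynomial, and the
  empty family gives \<open>matching_poly G\<close>.\<close>

lemma (in gain_graph) piece_poly_eq_cycle_expansion:
  "piece_poly G \<phi> = matching_poly G +
    (\<Sum>K \<in> cycle_subgraphs G.
      Polynomial.smult (complex_of_real
              ((- 2) ^ card (cycles_of K) * (\<Prod>C \<in> cycles_of K. Re (cycle_gain \<phi> C))))
        (matching_poly (delete_verts G (pverts K))))"
proof -
  let ?w = "\<lambda>\<C>. complex_of_real ((- 2) ^ card \<C> * (\<Prod>C \<in> \<C>. Re (cycle_gain \<phi> C)))"
  let ?f = "\<lambda>\<C> S. Polynomial.smult (?w \<C>) (matching_poly (delete_verts G S))"
  let ?P = "packings pverts (cycles_of G)"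
  have weight: "(\<Prod>C\<in>\<C>. - complex_of_real (2 * Re (cycle_gain \<phi> C))) = ?w \<C>" for \<C>
  proof -
    have "(\<Prod>C\<in>\<C>. - complex_of_real (2 * Re (cycle_gain \<phi> C))) =
        of_real (\<Prod>C\<in>\<C>. (- 2) * Re (cycle_gain \<phi> C))"
      by simp
    thus ?thesis
      by (simp only: prod.distrib prod_constant)
  qed
  have matching: "matching_poly (delete_verts G S) =
      packing_poly id (\<lambda>_. - 1 :: complex) {e \<in> edges G. disjnt (id e) S} (pverts G - S)" for S
  proof -
    interpret H: gain_graph "delete_verts G S" \<phi>
      by (rule gain_graph_delete_verts)
    show ?thesis
      using H.matching_poly_eq_packing_poly by (simp add: edges_delete_verts)
  qed
  have "piece_poly G \<phi> = (\<Sum>\<C>\<in>?P. ?f \<C> (\<Union>C\<in>\<C>. pverts C))"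
    unfolding piece_verts_def piece_weight_def pieces_def
      packing_poly_Plus[OF finite_edges finite_cycles_of] weight matching ..
  also have "\<dots> = ?f {} {} + (\<Sum>\<C>\<in>?P - {{}}. ?f \<C> (\<Union>C\<in>\<C>. pverts C))"
    using finite_packings[OF finite_cycles_of] by (subst sum.remove[of _ "{}"]) (auto simp: packings_def)
  also have "(\<Sum>\<C>\<in>?P - {{}}. ?f \<C> (\<Union>C\<in>\<C>. pverts C)) =
      (\<Sum>K\<in>cycle_subgraphs G. ?f (cycles_of K) (pverts K))"
    by (rule sum_cycle_subgraphs[OF pair_wf_digraph, symmetric])
  finally show ?thesis
    by simp
qed

section \<open>The recursion for the characteristic polynomial\<close>

definition char_entry :: "'a pair_pre_digraph \<Rightarrow> ('a \<times> 'a \<Rightarrow> complex) \<Rightarrow> 'a \<Rightarrow> 'a \<Rightarrow> complex poly" where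
  "char_entry G \<phi> a b =
    (if a = b then [:0, 1:] else 0) - [:if (a, b) \<in> parcs G then \<phi> (a, b) else 0:]"

text \<open>Consecutive vertices differ once the length is at least 2, so no diagonal entry occurs:
  the product is a constant, and a single missing arc makes it vanish.\<close>

lemma prod_char_entry_closed_walk:
  assumes "distinct l" "2 \<le> length l"
  shows "(\<Prod>(a, b)\<leftarrow>closed_walk_arcs l. char_entry G \<phi> a b) =
    (if set (closed_walk_arcs l) \<subseteq> parcs G then [:(- 1) ^ length l * walk_gain \<phi> l:] else 0)"
proof -
  have ne: "fst e \<noteq> snd e" if "e \<in> set (closed_walk_arcs l)" for e
  proof -
    obtain i where i: "i < length l" "e = (l ! i, l ! (Suc i mod length l))"
      using \<open>e \<in> set (closed_walk_arcs l)\<close> by (auto simp: set_closed_walk_arcs)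
    have "Suc i mod length l < length l" "Suc i mod length l \<noteq> i"
      using i(1) assms(2) by (auto simp: mod_Suc)
    thus ?thesis
      using i assms(1) by (simp add: nth_eq_iff_index_eq)
  qed
  have "(\<Prod>(a, b)\<leftarrow>es. char_entry G \<phi> a b) =
      (if set es \<subseteq> parcs G then [:(- 1) ^ length es * prod_list (map \<phi> es):] else 0)"
    if "\<forall>e\<in>set es. fst e \<noteq> snd e" for es
    using that by (induction es) (auto simp: char_entry_def)
  moreover have "length (closed_walk_arcs l) = length l"
    by (simp add: closed_walk_arcs_def)
  ultimately show ?thesis
    using ne by (simp add: walk_gain_def)
qed

text \<open>The walk \<open>[v, w]\<close> crosses its edge in both directions, so its two gains
  cancel to 1. It is its own reverse, so in contrast to longer cycles no factor 2 arises.\<close>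

lemma (in gain_graph) sum_closed_walks_2:
  fixes f :: "'a set \<Rightarrow> complex poly"
  shows "(\<Sum>l | distinct l \<and> length l = 2 \<and> hd l = v \<and> set (closed_walk_arcs l) \<subseteq> parcs G.
      Polynomial.smult (walk_gain \<phi> l) (f (set l))) = (\<Sum>e | e \<in> edges G \<and> v \<in> e. f e)"
\<comment> \<open>The definite description names the other endpoint of \<open>e\<close>.\<close>
proof (rule sum.reindex_cong[where l = "\<lambda>e. [v, THE u. e = {v, u}]"])
  have the: "(THE u. {v, w} = {v, u}) = w" for w
    by (rule the_equality) (auto simp: doubleton_eq_iff)
  have edge: "\<exists>w. e = {v, w} \<and> (v, w) \<in> parcs G" if "e \<in> edges G" "v \<in> e" for e
    using that arcs_symmetric by (auto simp: edges_def)
  show "inj_on (\<lambda>e. [v, THE u. e = {v, u}]) {e \<in> edges G. v \<in> e}"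
    using edge by (intro inj_onI) (auto simp: the dest!: edge)
  have arcs2: "closed_walk_arcs [v, w] = [(v, w), (w, v)]" for w
    by (simp add: closed_walk_arcs_def)
  show "{l. distinct l \<and> length l = 2 \<and> hd l = v \<and> set (closed_walk_arcs l) \<subseteq> parcs G} =
      (\<lambda>e. [v, THE u. e = {v, u}]) ` {e \<in> edges G. v \<in> e}" (is "?L = ?g ` ?E")
  proof (intro equalityI subsetI)
    fix l assume l: "l \<in> ?L"
    then obtain w where lw: "l = [v, w]"
      by (auto simp: length_Suc_conv numeral_2_eq_2)
    hence "{v, w} \<in> ?E"
      using l by (auto simp: arcs2 edges_def)
    moreover have "l = ?g {v, w}"
      by (simp add: lw the)
    ultimately show "l \<in> ?g ` ?E" by blast
  next
    fix l assume "l \<in> ?g ` ?E"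
    then obtain e where e: "e \<in> ?E" "l = ?g e"
      by blast
    then obtain w where "e = {v, w}" "(v, w) \<in> parcs G"
      using edge by blast
    hence "l = [v, w]" "(v, w) \<in> parcs G"
      by (simp_all add: e(2) the)
    thus "l \<in> ?L"
      using no_loops' arcs_symmetric by (auto simp: arcs2)
  qed
  fix e assume "e \<in> {e \<in> edges G. v \<in> e}"
  then obtain w where w: "e = {v, w}" "(v, w) \<in> parcs G"
    using edge by auto
  moreover have "\<phi> (v, w) \<noteq> 0"
    using gain_unit[OF w(2)] by auto
  moreover have "\<phi> (w, v) = inverse (\<phi> (v, w))"
    using gain_reverse arcs_symmetric w(2) by blast
  ultimately show "Polynomial.smult (walk_gain \<phi> [v, THE u. e = {v, u}])
      (f (set [v, THE u. e = {v, u}])) = f e"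
    by (simp add: the walk_gain_def arcs2)
qed

lemma (in gain_graph) set_det_char_entry_delete_verts:
  "set_det (char_entry (delete_verts G S) \<phi>) (pverts (delete_verts G S)) =
    set_det (char_entry G \<phi>) (pverts G - S)"
  unfolding delete_verts_simps by (rule set_det_cong) (simp add: char_entry_def)

text \<open>The lists of the cycle expansion are sorted by length: 1 is the fixed point with its
  factor x, 2 gives the edges, and 3 or more the cycles.\<close>

lemma (in gain_graph) set_det_char_entry_rec:
  assumes v: "v \<in> pverts G"
  shows "set_det (char_entry G \<phi>) (pverts G) =
    [:0, 1:] * set_det (char_entry G \<phi>) (pverts G - {v}) +
    (\<Sum>d | d \<in> pieces G \<and> v \<in> piece_verts d.
      Polynomial.smult (piece_weight \<phi> d) (set_det (char_entry G \<phi>) (pverts G - piece_verts d)))"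
proof -
  let ?D = "\<lambda>S. set_det (char_entry G \<phi>) (pverts G - S)"
  let ?L = "{l. distinct l \<and> set l \<subseteq> pverts G \<and> l \<noteq> [] \<and> hd l = v}"
  let ?t = "\<lambda>l. (- 1) ^ (length l - 1) *
    (\<Prod>(a, b)\<leftarrow>closed_walk_arcs l. char_entry G \<phi> a b) * ?D (set l)"
  let ?W = "\<lambda>P. {l. distinct l \<and> P (length l) \<and> hd l = v \<and> set (closed_walk_arcs l) \<subseteq> parcs G}"
  let ?u = "\<lambda>l. Polynomial.smult (walk_gain \<phi> l) (?D (set l))"
  have finL: "finite ?L"
    by (rule finite_distinct_lists_subset[OF pair_finite_verts])
  have WL: "?W (\<lambda>n. 2 \<le> n) \<subseteq> ?L - {[v]}"
  proof
    fix l assume l: "l \<in> ?W (\<lambda>n. 2 \<le> n)"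
    hence "2 \<le> length l"
      by simp
    hence ne: "l \<noteq> []" "l \<noteq> [v]"
      by auto
    have "map fst (closed_walk_arcs l) = l"
      by (simp add: closed_walk_arcs_def)
    hence "set l = fst ` set (closed_walk_arcs l)"
      by (metis set_map)
    also have "\<dots> \<subseteq> pverts G"
      using l arc_fst_in_verts by blast
    finally show "l \<in> ?L - {[v]}"
      using l ne by simp
  qed
  have finW: "finite (?W (\<lambda>n. 2 \<le> n))"
    using finite_subset[OF WL] finL by simp
  have long: "2 \<le> length l" if "l \<in> ?L - {[v]}" for l
    using that by (cases l; cases "tl l") auto
  have t: "?t l = (if set (closed_walk_arcs l) \<subseteq> parcs G then - ?u l else 0)" if l: "l \<in> ?L - {[v]}" for l
  proof -
    obtain m where m: "length l = Suc m"
      using l by (cases l) auto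
    \<comment> \<open>The exponents \<open>m\<close> and \<open>Suc m\<close> have opposite parity,
      so the sign of the cycle and the signs of its entries leave -1 for every length.\<close>
    have sign: "(- 1) ^ (length l - 1) * [:(- 1) ^ length l * walk_gain \<phi> l:] = [:- walk_gain \<phi> l:]"
      unfolding m by (cases "even m") auto
    have "distinct l"
      using l by simp
    note prod = prod_char_entry_closed_walk[OF this long[OF l], of G \<phi>]
    show ?thesis
    proof (cases "set (closed_walk_arcs l) \<subseteq> parcs G")
      case True
      have "?t l = [:- walk_gain \<phi> l:] * ?D (set l)"
        unfolding prod if_P[OF True] sign ..
      thus ?thesis
        using True by simp
    next
      case False
      thus ?thesis
        unfolding prod by simp
    qed
  qed
  have "set_det (char_entry G \<phi>) (pverts G) = sum ?t ?L"
    by (rule set_det_expand_cycle[OF pair_finite_verts v])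
  also have "\<dots> = ?t [v] + sum ?t (?L - {[v]})"
    using finL v by (intro sum.remove) auto
  also have "?t [v] = [:0, 1:] * ?D {v}"
    using no_loops'[of v v] by (auto simp: closed_walk_arcs_def char_entry_def)
  \<comment> \<open>A list with an arc outside \<open>G\<close> has a vanishing term, so only closed
    walks in \<open>G\<close> survive.\<close>
  also have "sum ?t (?L - {[v]}) = (\<Sum>l\<in>?W (\<lambda>n. 2 \<le> n). - ?u l)"
  proof (rule sum.mono_neutral_cong_right[OF _ WL])
    show "\<forall>l\<in>?L - {[v]} - ?W (\<lambda>n. 2 \<le> n). ?t l = 0"
    proof
      fix l assume l: "l \<in> ?L - {[v]} - ?W (\<lambda>n. 2 \<le> n)"
      hence "\<not> set (closed_walk_arcs l) \<subseteq> parcs G"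
        using long[of l] by auto
      thus "?t l = 0"
        using t[of l] l by (simp only: DiffD1 if_False)
    qed
    show "?t l = - ?u l" if "l \<in> ?W (\<lambda>n. 2 \<le> n)" for l
      using t[OF subsetD[OF WL that]] that by (simp only: mem_Collect_eq if_True)
  qed (use finL in simp)
  also have "\<dots> = - (\<Sum>l\<in>?W (\<lambda>n. n = 2) \<union> ?W (\<lambda>n. 3 \<le> n). ?u l)"
    unfolding sum_negf by (intro arg_cong[where f = uminus] sum.cong) auto
  also have "(\<Sum>l\<in>?W (\<lambda>n. n = 2) \<union> ?W (\<lambda>n. 3 \<le> n). ?u l) =
      sum ?u (?W (\<lambda>n. n = 2)) + sum ?u (?W (\<lambda>n. 3 \<le> n))"
    by (intro sum.union_disjoint finite_subset[OF _ finW]) auto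
  also have "sum ?u (?W (\<lambda>n. n = 2)) = (\<Sum>e | e \<in> edges G \<and> v \<in> e. ?D e)"
    by (rule sum_closed_walks_2)
  also have "sum ?u (?W (\<lambda>n. 3 \<le> n)) = (\<Sum>C | C \<in> cycles_of G \<and> v \<in> pverts C.
      Polynomial.smult (of_real (2 * Re (cycle_gain \<phi> C))) (?D (pverts C)))"
    by (rule sum_closed_walks_eq_sum_cycles)
  finally have main: "set_det (char_entry G \<phi>) (pverts G) = [:0, 1:] * ?D {v} +
      - ((\<Sum>e | e \<in> edges G \<and> v \<in> e. ?D e) +
        (\<Sum>C | C \<in> cycles_of G \<and> v \<in> pverts C.
          Polynomial.smult (of_real (2 * Re (cycle_gain \<phi> C))) (?D (pverts C))))" .
  have "{d \<in> pieces G. v \<in> piece_verts d} = {e \<in> edges G. v \<in> e} <+> {C \<in> cycles_of G. v \<in> pverts C}"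
    by (auto simp: pieces_def piece_verts_def)
  hence "(\<Sum>d | d \<in> pieces G \<and> v \<in> piece_verts d.
      Polynomial.smult (piece_weight \<phi> d) (?D (piece_verts d))) =
      (\<Sum>e | e \<in> edges G \<and> v \<in> e. - ?D e) + (\<Sum>C | C \<in> cycles_of G \<and> v \<in> pverts C.
        - Polynomial.smult (of_real (2 * Re (cycle_gain \<phi> C))) (?D (pverts C)))"
    using finite_edges finite_cycles_of
    by (simp add: sum.Plus piece_verts_def piece_weight_def)
  thus ?thesis
    unfolding main by (simp add: sum_negf)
qed

lemma set_det_char_entry_eq_piece_poly:
  assumes "gain_graph G \<phi>"
  shows "set_det (char_entry G \<phi>) (pverts G) = piece_poly G \<phi>"
  using assms
proof (induction "card (pverts G)" arbitrary: G rule: less_induct)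
  case less
  interpret gain_graph G \<phi> by fact
  show ?case
  proof (cases "pverts G = {}")
    \<comment> \<open>Without vertices there are no pieces; the empty permutation and the empty
      packing both give 1.\<close>
    case True
    hence "parcs G = {}"
      using arc_fst_in_verts by blast
    hence "edges G = {}"
      by (simp add: edges_def)
    moreover have "cycles_of G = {}"
      using is_cycle_verts(3) True by (auto simp: cycles_of_def subgraph_def)
    ultimately have "pieces G = {}"
      by (simp add: pieces_def)
    thus ?thesis
      using True by (simp add: packing_poly_def packings_empty)
  next
    case False
    then obtain v where v: "v \<in> pverts G" by blast
    \<comment> \<open>Every set deleted in the recursion contains \<open>v\<close>, so all graphs
      that it refers to are strictly smaller.\<close>
    have IH: "set_det (char_entry G \<phi>) (pverts G - S) = piece_poly (delete_verts G S) \<phi>"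
      if "v \<in> S" for S
    proof -
      have "card (pverts (delete_verts G S)) < card (pverts G)"
        using v that pair_finite_verts by (intro psubset_card_mono) auto
      from less.hyps[OF this gain_graph_delete_verts] show ?thesis
        by (simp only: set_det_char_entry_delete_verts)
    qed
    show ?thesis
      unfolding set_det_char_entry_rec[OF v] piece_poly_rec[OF v]
      by (intro arg_cong2[where f = "(+)"] sum.cong) (auto simp: IH)
  qed
qed

theorem theorem4p3:
  fixes G :: "'a pair_pre_digraph" and \<phi> :: "'a \<times> 'a \<Rightarrow> complex" and vs :: "'a list"
  assumes "gain_graph G \<phi>"
    and "distinct vs" and "set vs = pverts G"
  shows "char_poly (gain_adjacency_mat G \<phi> vs) =
    matching_poly G +
    (\<Sum>K \<in> cycle_subgraphs G.
      Polynomial.smult (complex_of_real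
              ((- 2) ^ card (cycles_of K) * (\<Prod>C \<in> cycles_of K. Re (cycle_gain \<phi> C))))
        (matching_poly (delete_verts G (pverts K))))"
proof -
  have "char_poly (gain_adjacency_mat G \<phi> vs) = set_det (char_entry G \<phi>) (set vs)"
    unfolding char_poly_def
  proof (rule det_eq_set_det)
    \<comment> \<open>Distinctness of \<open>vs\<close> turns equality of indices into equality of
      vertices, which puts x exactly on the diagonal.\<close>
    fix i j assume "i < length vs" "j < length vs"
    thus "char_poly_matrix (gain_adjacency_mat G \<phi> vs) $$ (i, j) = char_entry G \<phi> (vs ! i) (vs ! j)"
      using assms(2)
      by (auto simp: char_poly_matrix_def gain_adjacency_mat_def char_entry_def nth_eq_iff_index_eq)
  qed (use assms(2) in \<open>auto simp: char_poly_matrix_def gain_adjacency_mat_def\<close>)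
  thus ?thesis
    using set_det_char_entry_eq_piece_poly[OF assms(1)] assms(3)
      gain_graph.piece_poly_eq_cycle_expansion[OF assms(1)] by simp
qed

end
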